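(* Let $\Sigma$ be a finite alphabet and let $A \in \Sigma^{m_1\times n_1}$ and $B \in \Sigma^{m_2 \times n_2}$ be nonempty arrays ($m_1,n_1,m_2,n_2 \ge 1$). Consider the following conditions: (a) There exist positive integers $p_1, p_2, q_1, q_2$ such that $A^{p_1 \times q_1} = B^{p_2 \times q_2}$. (b) There exist a nonempty array $C$ and positive integers $r_1, r_2, s_1, s_2$ such that $A = C^{r_1 \times s_1}$ and $B = C^{r_2 \times s_2}$. (c$_h$) There exist positive integers $t_1, t_2, u_1, u_2$ such that $A^{t_1\times u_1}$ and $B^{t_2 \times u_2}$ have the same number of rows and $\mathrm{hcat}(A^{t_1 \times u_1}, B^{t_2 \times u_2}) = \mathrm{hcat}(B^{t_2 \times u_2}, A^{t_1 \times u_1})$. (c$_v$) There exist positive integers $t_1, t_2, u_1, u_2$ such that $A^{t_1\times u_1}$ and $B^{t_2 \times u_2}$ have the same number of columns and $\mathrm{vcat}(A^{t_1 \times u_1}, B^{t_2 \times u_2}) = \mathrm{vcat}(B^{t_2 \times u_2}, A^{t_1 \times u_1})$. Then (a), (b), (c$_h$) and (c$_v$) are equivalent.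
   Context: $\Sigma^{m\times n}$ denotes the set of $m\times n$ rectangular arrays with entries in $\Sigma$, indexed from $0$, so $A[i,j]$ with $0\le i<m$, $0\le j<n$. For $A\in\Sigma^{m\times n}$ and positive integers $p,q$, $A^{p\times q}$ is the $pm \times qn$ array $B$ with $B[i,j] = A[i \bmod m, j \bmod n]$ (i.e. $A$ repeated in $p$ rows and $q$ columns). If $A$ is $m\times n_1$ and $B$ is $m \times n_2$, $\mathrm{hcat}(A,B)$ is the $m\times(n_1+n_2)$ array obtained by placing $B$ to the right of $A$. If $A$ is $m_1\times n$ and $B$ is $m_2\times n$, $\mathrm{vcat}(A,B)$ is the $(m_1+m_2)\times n$ array obtained by placing $B$ underneath $A$. *)

theory Defs
  imports "Jordan_Normal_Form.Matrix"
begin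

definition arrays :: "'a set \<Rightarrow> nat \<Rightarrow> nat \<Rightarrow> 'a mat set" where
  "arrays \<Sigma> m n = {A \<in> carrier_mat m n. elements_mat A \<subseteq> \<Sigma>}"

definition array_power :: "'a mat \<Rightarrow> nat \<Rightarrow> nat \<Rightarrow> 'a mat" where
  "array_power A p q =
     mat (p * dim_row A) (q * dim_col A) (\<lambda>(i, j). A $$ (i mod dim_row A, j mod dim_col A))"

text \<open>The library's \<open>append_rows\<close> needs a zero in the entry type, hence the separate
  definitions. As in the mathematics, \<open>hcat A B\<close> is meaningful only if \<open>A\<close> and \<open>B\<close> have
  equally many rows, and \<open>vcat A B\<close> only if they have equally many columns.\<close>

definition hcat :: "'a mat \<Rightarrow> 'a mat \<Rightarrow> 'a mat" where
  "hcat A B = mat (dim_row A) (dim_col A + dim_col B)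
     (\<lambda>(i, j). if j < dim_col A then A $$ (i, j) else B $$ (i, j - dim_col A))"

definition vcat :: "'a mat \<Rightarrow> 'a mat \<Rightarrow> 'a mat" where
  "vcat A B = mat (dim_row A + dim_row B) (dim_col A)
     (\<lambda>(i, j). if i < dim_row A then A $$ (i, j) else B $$ (i - dim_row A, j))"

end

theory Submission
  imports Defs
begin

text \<open>
  All four conditions say that the periodic extensions of \<open>A\<close> and \<open>B\<close> to the whole quadrant
  coincide. Powers do not change the extension, which settles (a). If the extensions coincide,
  the common function has both row counts and both column counts as periods, hence also their
  gcds, and its restriction to a gcd-sized rectangle is the common root \<open>C\<close> of (b). If two arrays
  commute under concatenation, then so do their corresponding rows (or columns) as words, and
  two commuting words have the same infinite repetition.
\<close>

section \<open>Periods of functions and commuting words\<close>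

lemma periodic_add_mult:
  fixes f :: "nat \<Rightarrow> 'b"
  assumes "\<And>i. f (i + p) = f i"
  shows "f (i + k * p) = f i"
proof (induction k)
  case (Suc k)
  show ?case
    using assms[of "i + k * p"] Suc by (simp add: algebra_simps)
qed simp

lemma periodic_mod:
  fixes f :: "nat \<Rightarrow> 'b"
  assumes "\<And>i. f (i + p) = f i"
  shows "f (i mod p) = f i"
  using periodic_add_mult[of f p "i mod p" "i div p", OF assms] by simp

text \<open>Bezout's identity over the naturals writes \<open>gcd a b\<close> as
  \<open>a * x - b * y\<close>, so a shift by the gcd followed by \<open>y\<close> shifts by
  \<open>b\<close> equals \<open>x\<close> shifts by \<open>a\<close>. Positivity of
  \<open>a\<close> guarantees the identity in this orientation.\<close>

lemma periodic_gcd: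
  fixes f :: "nat \<Rightarrow> 'b"
  assumes a: "\<And>i. f (i + a) = f i" and b: "\<And>i. f (i + b) = f i" and "a > 0"
  shows "f (i + gcd a b) = f i"
proof -
  obtain x y where xy: "a * x = b * y + gcd a b"
    using bezout_nat[of a b] \<open>a > 0\<close> by auto
  have "f (i + gcd a b) = f (i + gcd a b + y * b)"
    using periodic_add_mult[of f b "i + gcd a b" y, OF b] by simp
  also have "i + gcd a b + y * b = i + x * a"
    using xy by (simp add: algebra_simps)
  also have "f (i + x * a) = f i"
    using periodic_add_mult[of f a i x, OF a] .
  finally show ?thesis .
qed

text \<open>A word of length \<open>a\<close> is a function restricted to arguments below \<open>a\<close>. The induction is
  Euclid's algorithm on the lengths: the shorter word is a prefix of the longer one and commutes
  with what remains.\<close>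

lemma commuting_words_same_extension:
  fixes x y :: "nat \<Rightarrow> 'b"
  assumes "a > 0" and "b > 0"
    and "\<And>j. j < a + b \<Longrightarrow>
      (if j < a then x j else y (j - a)) = (if j < b then y j else x (j - b))"
  shows "x (i mod a) = y (i mod b)"
  using assms
proof (induction "a + b" arbitrary: a b x y i rule: less_induct)
  case less
  \<comment> \<open>Arbitrary words \<open>u\<close>, \<open>v\<close> are allowed here so that the
    cases \<open>a < b\<close> and \<open>b < a\<close> both become instances, with the roles of
    \<open>x\<close> and \<open>y\<close> exchanged in the second.\<close>
  have shorter: "u (i mod c) = v (i mod d)"
    if cd: "c < d" "c > 0" "c + d = a + b"
      and comm: "\<And>j. j < c + d \<Longrightarrow>
        (if j < c then u j else v (j - c)) = (if j < d then v j else u (j - d))"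
    for u v :: "nat \<Rightarrow> 'b" and c d i
  proof -
    \<comment> \<open>Since \<open>c < d\<close>, the equation uv = vu makes \<open>u\<close> a
      prefix of \<open>v\<close>, and \<open>v'\<close> is the rest. Cancelling the leading
      \<open>u\<close> in uuv' = uv'u leaves uv' = v'u, with total length
      \<open>d < c + d\<close>.\<close>
    define v' where "v' j = v (j + c)" for j
    have IH: "u (i mod c) = v' (i mod (d - c))" for i
    proof (rule less.hyps)
      show "c + (d - c) < a + b" "c > 0" "d - c > 0"
        using cd by auto
      fix j assume j: "j < c + (d - c)"
      show "(if j < c then u j else v' (j - c)) = (if j < d - c then v' j else u (j - (d - c)))"
        using comm[of j] comm[of "j + c"] cd j by (auto simp: v'_def split: if_splits)
    qed
    \<comment> \<open>The word \<open>v\<close> is a prefix of the infinite repetition of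
      \<open>u\<close>: it starts with \<open>u\<close>, and \<open>v'\<close> continues the
      repetition by \<open>IH\<close>.\<close>
    have v: "v k = u (k mod c)" if "k < d" for k
    proof (cases "k < c")
      case True
      then show ?thesis using comm[of k] that by simp
    next
      case False
      then show ?thesis
        using IH[of "k - c"] that by (simp add: v'_def le_mod_geq)
    qed
    \<comment> \<open>The repetition of \<open>u\<close> has period \<open>c\<close>, and also
      period \<open>d - c\<close> because it equals that of \<open>v'\<close>. Hence it has period
      \<open>d\<close>, which allows the reduction modulo \<open>d\<close> below.\<close>
    have "u ((i + d) mod c) = u (i mod c)" for i
    proof -
      have "i + d = (i + (d - c)) + c"
        using cd by simp
      then have "u ((i + d) mod c) = u ((i + (d - c)) mod c)"
        by (metis mod_add_self2)
      also have "\<dots> = u (i mod c)"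
        using IH[of "i + (d - c)"] IH[of i] by simp
      finally show ?thesis .
    qed
    from periodic_mod[of "\<lambda>i. u (i mod c)", OF this]
    have "u (i mod d mod c) = u (i mod c)" .
    then show ?thesis
      using v[of "i mod d"] cd by simp
  qed
  consider "a < b" | "b < a" | "a = b"
    by linarith
  then show ?case
  proof cases
    case 1
    then show ?thesis using shorter[of a b x y] less.prems by blast
  next
    case 2
    have "y (i mod b) = x (i mod a)"
    proof (rule shorter)
      show "(if j < b then y j else x (j - b)) = (if j < a then x j else y (j - a))"
        if "j < b + a" for j
        using less.prems(3)[of j] that by (simp only: add.commute)
    qed (use 2 less.prems(1,2) in auto)
    then show ?thesis ..
  next
    case 3
    then show ?thesis using less.prems(1) less.prems(3)[of "i mod a"] by (simp add: trans_less_add1)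
  qed
qed

section \<open>Periodic extensions of arrays and their powers\<close>

text \<open>The curried form lets the lemmas on periods apply in both directions: to the map from
  row indices to rows, and to each single row.\<close>

definition periodic_extension :: "'a mat \<Rightarrow> nat \<Rightarrow> nat \<Rightarrow> 'a" where
  "periodic_extension A i j = A $$ (i mod dim_row A, j mod dim_col A)"

lemma dim_array_power [simp]:
  "dim_row (array_power A p q) = p * dim_row A"
  "dim_col (array_power A p q) = q * dim_col A"
  by (simp_all add: array_power_def)

lemma periodic_extension_array_power:
  assumes "dim_row A > 0" "dim_col A > 0" "p > 0" "q > 0"
  shows "periodic_extension (array_power A p q) = periodic_extension A"
  using assms by (intro ext) (simp add: periodic_extension_def array_power_def mod_mod_cancel)

lemma periodic_extension_eq_if_array_power_eq:
  assumes "dim_row A > 0" "dim_col A > 0" "dim_row B > 0" "dim_col B > 0"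
    and "p1 > 0" "p2 > 0" "q1 > 0" "q2 > 0"
    and "array_power A p1 q1 = array_power B p2 q2"
  shows "periodic_extension A = periodic_extension B"
  using assms periodic_extension_array_power by metis

text \<open>Taking the dimensions of the other array as exponents gives both powers the same size,
  and each entry is a value of the common extension.\<close>

lemma array_power_eq_if_periodic_extension_eq:
  assumes "periodic_extension A = periodic_extension B"
  shows "array_power A (dim_row B) (dim_col B) = array_power B (dim_row A) (dim_col A)"
proof -
  have "A $$ (i mod dim_row A, j mod dim_col A) = B $$ (i mod dim_row B, j mod dim_col B)" for i j
    using fun_cong[OF fun_cong[OF assms, of i], of j] by (simp add: periodic_extension_def)
  then show ?thesis
    by (simp add: array_power_def mult.commute)
qed

section \<open>Arrays that commute under concatenation\<close>

lemma periodic_extension_eq_if_hcat_commute: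
  assumes "dim_col X > 0" "dim_col Y > 0" "dim_row X > 0" and rows: "dim_row X = dim_row Y"
    and comm: "hcat X Y = hcat Y X"
  shows "periodic_extension X = periodic_extension Y"
proof (intro ext)
  fix i j
  define r where "r = i mod dim_row X"
  have r: "r < dim_row X"
    using assms by (simp add: r_def)
  \<comment> \<open>Row \<open>r\<close> of the two concatenations shows that the rows
    \<open>r\<close> of \<open>X\<close> and \<open>Y\<close> commute as words. As the row counts
    agree, the same \<open>r\<close> is the reduced row index for both arrays.\<close>
  have "X $$ (r, j mod dim_col X) = Y $$ (r, j mod dim_col Y)"
  proof (rule commuting_words_same_extension)
    fix k assume "k < dim_col X + dim_col Y"
    then show "(if k < dim_col X then X $$ (r, k) else Y $$ (r, k - dim_col X)) =
        (if k < dim_col Y then Y $$ (r, k) else X $$ (r, k - dim_col Y))"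
      using arg_cong[OF comm, of "\<lambda>Z. Z $$ (r, k)"] r rows
      by (simp add: hcat_def add.commute)
  qed (use assms in auto)
  then show "periodic_extension X i j = periodic_extension Y i j"
    using rows by (simp add: periodic_extension_def r_def)
qed

lemma periodic_extension_eq_if_vcat_commute:
  assumes "dim_row X > 0" "dim_row Y > 0" "dim_col X > 0" and cols: "dim_col X = dim_col Y"
    and comm: "vcat X Y = vcat Y X"
  shows "periodic_extension X = periodic_extension Y"
proof (intro ext)
  fix i j
  define c where "c = j mod dim_col X"
  have c: "c < dim_col X"
    using assms by (simp add: c_def)
  have "X $$ (i mod dim_row X, c) = Y $$ (i mod dim_row Y, c)"
  proof (rule commuting_words_same_extension[where x = "\<lambda>k. X $$ (k, c)" and y = "\<lambda>k. Y $$ (k, c)"])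
    fix k assume "k < dim_row X + dim_row Y"
    then show "(if k < dim_row X then X $$ (k, c) else Y $$ (k - dim_row X, c)) =
        (if k < dim_row Y then Y $$ (k, c) else X $$ (k - dim_row Y, c))"
      using arg_cong[OF comm, of "\<lambda>Z. Z $$ (k, c)"] c cols
      by (simp add: vcat_def add.commute)
  qed (use assms in auto)
  then show "periodic_extension X i j = periodic_extension Y i j"
    using cols by (simp add: periodic_extension_def c_def)
qed

section \<open>The common root\<close>

lemma common_root_if_periodic_extension_eq:
  assumes A: "A \<in> arrays \<Sigma> m1 n1" and B: "B \<in> arrays \<Sigma> m2 n2"
    and pos: "m1 > 0" "n1 > 0" "m2 > 0" "n2 > 0"
    and eq: "periodic_extension A = periodic_extension B"
  obtains C where "C \<in> arrays \<Sigma> (gcd m1 m2) (gcd n1 n2)"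
    and "A = array_power C (m1 div gcd m1 m2) (n1 div gcd n1 n2)"
    and "B = array_power C (m2 div gcd m1 m2) (n2 div gcd n1 n2)"
proof -
  define f where "f = periodic_extension A"
  define m n where "m = gcd m1 m2" and "n = gcd n1 n2"
  \<comment> \<open>Read through \<open>A\<close>, the function \<open>f\<close> has periods
    \<open>m1\<close> and \<open>n1\<close>; read through \<open>B\<close>, it has periods
    \<open>m2\<close> and \<open>n2\<close>.\<close>
  have fA: "f i j = A $$ (i mod m1, j mod n1)" for i j
    using A by (auto simp: f_def periodic_extension_def arrays_def)
  have fB: "f i j = B $$ (i mod m2, j mod n2)" for i j
    using B by (auto simp: f_def eq periodic_extension_def arrays_def)
  have rowA: "f (i + m1) = f i" and rowB: "f (i + m2) = f i" for i
    unfolding fun_eq_iff by (simp add: fA) (simp add: fB)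
  have row: "f (i mod m) = f i" for i
    unfolding m_def using periodic_mod[of f, OF periodic_gcd[of f, OF rowA rowB \<open>m1 > 0\<close>]] .
  have colA: "f i (j + n1) = f i j" and colB: "f i (j + n2) = f i j" for i j
    by (simp add: fA) (simp add: fB)
  have col: "f i (j mod n) = f i j" for i j
    unfolding n_def
    using periodic_mod[of "f i", OF periodic_gcd[of "f i", OF colA colB \<open>n1 > 0\<close>]] .
  \<comment> \<open>The bounds place the rectangle of \<open>C\<close> inside \<open>A\<close>, so
    that its entries are entries of \<open>A\<close> and lie in \<open>\<Sigma>\<close>.\<close>
  have mn: "m > 0" "n > 0" "m \<le> m1" "n \<le> n1"
    using pos by (auto simp: m_def n_def intro: gcd_le1_nat)
  define C where "C = mat m n (\<lambda>(i, j). f i j)"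
  have C: "array_power C (k div m) (l div n) = mat k l (\<lambda>(i, j). f i j)"
    if "m dvd k" "n dvd l" for k l
    using that mn by (intro eq_matI) (auto simp: array_power_def C_def row col)
  have "C \<in> arrays \<Sigma> m n"
  proof -
    have "f i j \<in> \<Sigma>" if "i < m" "j < n" for i j
    proof -
      have "A $$ (i, j) \<in> elements_mat A"
        using A that mn by (intro elements_matI[of A m1 n1 i j]) (auto simp: arrays_def)
      then show ?thesis
        using A that mn by (auto simp: fA arrays_def)
    qed
    then show ?thesis
      by (auto simp: C_def arrays_def elements_mat_def)
  qed
  moreover have "A = array_power C (m1 div m) (n1 div n)"
    using A by (subst C) (auto simp: m_def n_def fA arrays_def intro!: eq_matI)
  moreover have "B = array_power C (m2 div m) (n2 div n)"
    using B by (subst C) (auto simp: m_def n_def fB arrays_def intro!: eq_matI)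
  ultimately show ?thesis
    using that by (simp add: m_def n_def)
qed

section \<open>Equivalence of the four conditions\<close>

theorem theorem3:
  fixes \<Sigma> :: "'a set" and A B :: "'a mat" and m1 n1 m2 n2 :: nat
  assumes "finite \<Sigma>"
    and "m1 \<ge> 1" and "n1 \<ge> 1" and "m2 \<ge> 1" and "n2 \<ge> 1"
    and "A \<in> arrays \<Sigma> m1 n1" and "B \<in> arrays \<Sigma> m2 n2"
  shows
    "let a = (\<exists>p1 p2 q1 q2. p1 > 0 \<and> p2 > 0 \<and> q1 > 0 \<and> q2 > 0 \<and>
               array_power A p1 q1 = array_power B p2 q2);
         b = (\<exists>m n C r1 r2 s1 s2. m > 0 \<and> n > 0 \<and> C \<in> arrays \<Sigma> m n \<and>
               r1 > 0 \<and> r2 > 0 \<and> s1 > 0 \<and> s2 > 0 \<and>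
               A = array_power C r1 s1 \<and> B = array_power C r2 s2);
         c\<^sub>h = (\<exists>t1 t2 u1 u2. t1 > 0 \<and> t2 > 0 \<and> u1 > 0 \<and> u2 > 0 \<and>
               dim_row (array_power A t1 u1) = dim_row (array_power B t2 u2) \<and>
               hcat (array_power A t1 u1) (array_power B t2 u2) =
               hcat (array_power B t2 u2) (array_power A t1 u1));
         c\<^sub>v = (\<exists>t1 t2 u1 u2. t1 > 0 \<and> t2 > 0 \<and> u1 > 0 \<and> u2 > 0 \<and>
               dim_col (array_power A t1 u1) = dim_col (array_power B t2 u2) \<and>
               vcat (array_power A t1 u1) (array_power B t2 u2) =
               vcat (array_power B t2 u2) (array_power A t1 u1))
     in (a \<longleftrightarrow> b) \<and> (b \<longleftrightarrow> c\<^sub>h) \<and> (c\<^sub>h \<longleftrightarrow> c\<^sub>v)"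
proof -
  have dimA: "dim_row A = m1" "dim_col A = n1" and dimB: "dim_row B = m2" "dim_col B = n2"
    using assms by (auto simp: arrays_def)
  have pos: "m1 > 0" "n1 > 0" "m2 > 0" "n2 > 0"
    using assms by auto
  define E where "E \<longleftrightarrow> periodic_extension A = periodic_extension B"
  have powers: "array_power A m2 n2 = array_power B m1 n1" if E
    using array_power_eq_if_periodic_extension_eq[of A B] that by (simp add: E_def dimA dimB)
  have a: "(\<exists>p1 p2 q1 q2. p1 > 0 \<and> p2 > 0 \<and> q1 > 0 \<and> q2 > 0 \<and>
      array_power A p1 q1 = array_power B p2 q2) \<longleftrightarrow> E" (is "?a \<longleftrightarrow> E")
  proof
    assume ?a
    then show E
      unfolding E_def using periodic_extension_eq_if_array_power_eq[of A B] pos dimA dimB by blast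
  next
    assume E
    then show ?a
      using powers pos by blast
  qed
  have b: "(\<exists>m n C r1 r2 s1 s2. m > 0 \<and> n > 0 \<and> C \<in> arrays \<Sigma> m n \<and>
      r1 > 0 \<and> r2 > 0 \<and> s1 > 0 \<and> s2 > 0 \<and>
      A = array_power C r1 s1 \<and> B = array_power C r2 s2) \<longleftrightarrow> E" (is "?b \<longleftrightarrow> E")
  proof
    assume ?b
    then obtain m n C r1 r2 s1 s2 where C: "C \<in> arrays \<Sigma> m n" "m > 0" "n > 0"
      "r1 > 0" "r2 > 0" "s1 > 0" "s2 > 0" "A = array_power C r1 s1" "B = array_power C r2 s2"
      by blast
    then have "dim_row C > 0" "dim_col C > 0"
      by (auto simp: arrays_def)
    \<comment> \<open>The extensions of \<open>A\<close> and \<open>B\<close> both equal that of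
      \<open>C\<close>.\<close>
    then show E
      unfolding E_def C(8,9) using C(4-7) by (simp add: periodic_extension_array_power)
  next
    assume E
    then obtain C where C: "C \<in> arrays \<Sigma> (gcd m1 m2) (gcd n1 n2)"
      "A = array_power C (m1 div gcd m1 m2) (n1 div gcd n1 n2)"
      "B = array_power C (m2 div gcd m1 m2) (n2 div gcd n1 n2)"
      using common_root_if_periodic_extension_eq[OF assms(6,7) pos] unfolding E_def by blast
    have "gcd m1 m2 > 0" "gcd n1 n2 > 0"
      "m1 div gcd m1 m2 > 0" "m2 div gcd m1 m2 > 0" "n1 div gcd n1 n2 > 0" "n2 div gcd n1 n2 > 0"
      using pos by (auto simp: div_greater_zero_iff intro: gcd_le1_nat gcd_le2_nat)
    with C show ?b
      by blast
  qed
  have ch: "(\<exists>t1 t2 u1 u2. t1 > 0 \<and> t2 > 0 \<and> u1 > 0 \<and> u2 > 0 \<and>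
      dim_row (array_power A t1 u1) = dim_row (array_power B t2 u2) \<and>
      hcat (array_power A t1 u1) (array_power B t2 u2) =
      hcat (array_power B t2 u2) (array_power A t1 u1)) \<longleftrightarrow> E" (is "?ch \<longleftrightarrow> E")
  proof
    assume ?ch
    then obtain t1 t2 u1 u2 where t: "t1 > 0" "t2 > 0" "u1 > 0" "u2 > 0"
      and rows: "dim_row (array_power A t1 u1) = dim_row (array_power B t2 u2)"
      and comm: "hcat (array_power A t1 u1) (array_power B t2 u2) =
        hcat (array_power B t2 u2) (array_power A t1 u1)"
      by blast
    have "periodic_extension (array_power A t1 u1) = periodic_extension (array_power B t2 u2)"
      by (rule periodic_extension_eq_if_hcat_commute[OF _ _ _ rows comm])
        (use t pos in \<open>auto simp: dimA dimB\<close>)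
    then show E
      using t pos by (simp add: E_def periodic_extension_array_power dimA dimB)
  next
    assume E
    \<comment> \<open>The two equal arrays of \<open>powers\<close> have the same number of rows and
      commute trivially.\<close>
    then show ?ch
      using powers pos by metis
  qed
  have cv: "(\<exists>t1 t2 u1 u2. t1 > 0 \<and> t2 > 0 \<and> u1 > 0 \<and> u2 > 0 \<and>
      dim_col (array_power A t1 u1) = dim_col (array_power B t2 u2) \<and>
      vcat (array_power A t1 u1) (array_power B t2 u2) =
      vcat (array_power B t2 u2) (array_power A t1 u1)) \<longleftrightarrow> E" (is "?cv \<longleftrightarrow> E")
  proof
    assume ?cv
    then obtain t1 t2 u1 u2 where t: "t1 > 0" "t2 > 0" "u1 > 0" "u2 > 0"
      and cols: "dim_col (array_power A t1 u1) = dim_col (array_power B t2 u2)"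
      and comm: "vcat (array_power A t1 u1) (array_power B t2 u2) =
        vcat (array_power B t2 u2) (array_power A t1 u1)"
      by blast
    have "periodic_extension (array_power A t1 u1) = periodic_extension (array_power B t2 u2)"
      by (rule periodic_extension_eq_if_vcat_commute[OF _ _ _ cols comm])
        (use t pos in \<open>auto simp: dimA dimB\<close>)
    then show E
      using t pos by (simp add: E_def periodic_extension_array_power dimA dimB)
  next
    assume E
    \<comment> \<open>The same equal powers serve for vertical concatenation.\<close>
    then show ?cv
      using powers pos by metis
  qed
  show ?thesis
    unfolding Let_def a b ch cv by simp
qed

end
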